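(* Let $x$ be a complex number and $n$ a nonnegative integer such that all quantities below are defined. Then \[ \sum_{k=0}^n\binom{2n-k}{n}\binom{x+k}{k}H_{k}^{\langle2\rangle}(x)=\frac{\binom{x+2n+1}{n}}{8} \Big\{4H_{2n}^{\langle2\rangle}(x+1) -\big[H_n(\tfrac{x}{2})-H_n(\tfrac{x+1}{2})\big]\big[H_n(\tfrac{x}{2})-H_n(\tfrac{x+1}{2})-\tfrac{4}{x+1}\big]\Big\}. \]
   Context: For a complex $y$ and an integer $k\ge 0$, $\binom{y}{k}=\frac{y(y-1)\cdots(y-k+1)}{k!}$. For complex $x$, integer $n\ge 0$ and positive integer $\ell$: $H_0^{\langle\ell\rangle}(x)=0$, $H_n^{\langle\ell\rangle}(x)=\sum_{k=1}^n\frac{1}{(x+k)^\ell}$, and $H_n(x)=H_n^{\langle1\rangle}(x)$. *)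

theory Defs
  imports Complex_Main
begin

definition gen_harm :: "nat \<Rightarrow> nat \<Rightarrow> complex \<Rightarrow> complex" where
  "gen_harm l n x = (\<Sum>k=1..n. 1 / (x + of_nat k) ^ l)"

abbreviation harm1 :: "nat \<Rightarrow> complex \<Rightarrow> complex" where
  "harm1 n x \<equiv> gen_harm 1 n x"

end

theory Submission
  imports Defs
begin

text \<open>
  Put \<open>t\<^sub>k(y) = (1 - y\<^sup>2/(x+1)\<^sup>2) \<cdots> (1 - y\<^sup>2/(x+k)\<^sup>2)\<close>, whose \<open>y\<^sup>2\<close> coefficient is
  \<open>- H\<^sub>k\<^sup>\<langle>\<^sup>2\<^sup>\<rangle>(x)\<close>. The theorem is the \<open>y\<^sup>2\<close> coefficient of the statement that
  the even part of the product of \<open>1 + (-1)\<^sup>i y/(x+i)\<close> over \<open>1 \<le> i \<le> 2n+1\<close> has the coordinates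
  \<open>w\<^sub>n(k) = C(2n-k,n) C(x+k,k) / C(x+2n+1,n)\<close> in the basis \<open>t\<^sub>k\<close>; the odd part divided by \<open>y\<close> has
  the coordinates \<open>- w\<^sub>n(k)/(x+k+1)\<close>. Multiplying by the next two factors gives one recurrence
  for \<open>w\<close>, in which \<open>w\<^sub>n\<^sub>+\<^sub>1(k) - w\<^sub>n(k)\<close> is a difference in \<open>k\<close>. By induction on \<open>n\<close>
  it yields the sums of \<open>w\<^sub>n(k)\<close>, of \<open>w\<^sub>n(k)/(x+k+1)\<close> and, by summation by parts, of
  \<open>w\<^sub>n(k) H\<^sub>k\<^sup>\<langle>\<^sup>2\<^sup>\<rangle>(x)\<close>.
\<close>

section \<open>Telescoping, summation by parts and binomial identities\<close>

lemma sum_telescope_atMost: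
  fixes V :: "nat \<Rightarrow> 'a::ab_group_add"
  shows "(\<Sum>k\<le>m. V k - V (Suc k)) = V 0 - V (Suc m)"
  by (induction m) auto

lemma summation_by_parts:
  fixes V H :: "nat \<Rightarrow> 'a::comm_ring"
  shows "(\<Sum>k\<le>m. (V k - V (Suc k)) * H k) =
    V 0 * H 0 - V (Suc m) * H (Suc m) + (\<Sum>k\<le>m. V (Suc k) * (H (Suc k) - H k))"
  by (induction m) (auto simp: algebra_simps)

lemma gen_harm_0 [simp]: "gen_harm l 0 x = 0"
  by (simp add: gen_harm_def)

lemma gen_harm_Suc: "gen_harm l (Suc n) x = gen_harm l n x + 1 / (x + of_nat (Suc n)) ^ l"
  by (simp add: gen_harm_def)

text \<open>Absorption leads from z+2 over n+1 to z+1 over n, and complementary absorption from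
  there to z over n. This is the change in \<open>denom\<close> when n grows by one.\<close>

lemma gbinomial_shift:
  fixes z :: "'a::field_char_0"
  shows "of_nat (Suc n) * (z + 1 - of_nat n) * ((z + 2) gchoose Suc n) = (z + 2) * (z + 1) * (z gchoose n)"
proof -
  have "of_nat (Suc n) * (((z + 1) + 1) gchoose Suc n) = ((z + 1) + 1) * ((z + 1) gchoose n)"
    by (rule Suc_times_gbinomial)
  then have "of_nat (Suc n) * ((z + 2) gchoose Suc n) = (z + 2) * ((z + 1) gchoose n)"
    by (simp add: add.assoc)
  moreover have "(z + 1 - of_nat n) * ((z + 1) gchoose n) = (z + 1) * (z gchoose n)"
    using gbinomial_absorb_comp[of "z + 1" n] by simp
  ultimately show ?thesis
    by algebra
qed

section \<open>The normalised weights and their ratios\<close>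

definition denom :: "complex \<Rightarrow> nat \<Rightarrow> complex" where
  "denom x n = ((x + 2 * of_nat n + 1) gchoose n)"

lemma denom_Suc:
  "of_nat (Suc n) * (x + of_nat n + 2) * denom x (Suc n) =
    (x + 2 * of_nat n + 2) * (x + 2 * of_nat n + 3) * denom x n"
  using gbinomial_shift[of n "x + 2 * of_nat n + 1"]
  by (simp add: denom_def algebra_simps)

text \<open>In \<open>denom_Suc\<close> the right side is nonzero by induction, hence so is every
  factor on the left.\<close>

lemma denom_nonzero:
  assumes "\<forall>k\<in>{1..2 * n + 1}. x + of_nat k \<noteq> 0"
  shows "denom x n \<noteq> 0"
  using assms
proof (induction n)
  case 0
  then show ?case by (simp add: denom_def)
next
  case (Suc n)
  have "denom x n \<noteq> 0"
    using Suc by simp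
  moreover have "x + 2 * of_nat n + 2 \<noteq> 0" "x + 2 * of_nat n + 3 \<noteq> 0"
    using Suc.prems[rule_format, of "2 * n + 2"] Suc.prems[rule_format, of "2 * n + 3"]
    by (simp_all add: algebra_simps)
  ultimately show ?case
    using denom_Suc[of n x] by auto
qed

text \<open>The case distinction matters only for \<open>n = 0\<close>: there \<open>(2 * n - k) choose n\<close> is 1 for all \<open>k\<close>.\<close>

definition weight :: "complex \<Rightarrow> nat \<Rightarrow> nat \<Rightarrow> complex" where
  "weight x n k =
    (if k \<le> n then of_nat ((2 * n - k) choose n) * ((x + of_nat k) gchoose k) / denom x n else 0)"

lemma gbinomial_diagonal_Suc:
  fixes x :: "'a::field_char_0"
  shows "of_nat (Suc k) * ((x + of_nat (Suc k)) gchoose Suc k) = (x + of_nat k + 1) * ((x + of_nat k) gchoose k)"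
  using Suc_times_gbinomial[of k "x + of_nat k"] by (simp add: add_ac)

text \<open>The hypergeometric ratio in k, cross-multiplied so that no factor has to be inverted. At
  k = n both sides vanish, the left one by the cutoff in \<open>weight\<close>.\<close>

lemma weight_Suc_right:
  assumes "k \<le> n"
  shows "of_nat (Suc k) * (2 * of_nat n - of_nat k) * weight x n (Suc k) =
    (of_nat n - of_nat k) * (x + of_nat k + 1) * weight x n k"
proof (cases "k = n")
  case True
  then show ?thesis by (simp add: weight_def)
next
  case False
  with assms have k: "k < n" by simp
  have "(2 * n - k - n) * ((2 * n - k) choose n) = (2 * n - k) * ((2 * n - k - 1) choose n)"
    by (rule binomial_absorb_comp)
  then have "(n - k) * ((2 * n - k) choose n) = (2 * n - k) * ((2 * n - Suc k) choose n)"
    using k by simp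
  then have "of_nat ((n - k) * ((2 * n - k) choose n)) =
      (of_nat ((2 * n - k) * ((2 * n - Suc k) choose n)) :: complex)"
    by (rule arg_cong)
  then have b: "(of_nat n - of_nat k) * of_nat ((2 * n - k) choose n) =
      (2 * of_nat n - of_nat k) * (of_nat ((2 * n - Suc k) choose n) :: complex)"
    using k by (simp add: of_nat_diff)
  have "of_nat (Suc k) * (2 * of_nat n - of_nat k) * weight x n (Suc k) =
      ((2 * of_nat n - of_nat k) * of_nat ((2 * n - Suc k) choose n)) *
      (of_nat (Suc k) * ((x + of_nat (Suc k)) gchoose Suc k)) / denom x n"
    using k by (simp only: weight_def) simp
  also have "\<dots> = ((of_nat n - of_nat k) * of_nat ((2 * n - k) choose n)) *
      ((x + of_nat k + 1) * ((x + of_nat k) gchoose k)) / denom x n"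
    by (simp only: b gbinomial_diagonal_Suc)
  finally show ?thesis
    using k by (simp add: weight_def mult_ac)
qed

text \<open>Raising n and k together turns C(2n-k,n) into C(2n-k+1,n+1), a single absorption. This
  reaches every positive index at level n+1; index 0 is left to \<open>weight_Suc_0\<close>.\<close>

lemma weight_Suc_Suc:
  assumes "\<forall>k\<in>{1..2 * Suc n + 1}. x + of_nat k \<noteq> 0" and k: "k \<le> n"
  shows "of_nat (Suc k) * ((x + 2 * of_nat n + 2) * (x + 2 * of_nat n + 3)) * weight x (Suc n) (Suc k) =
    (2 * of_nat n + 1 - of_nat k) * (x + of_nat n + 2) * (x + of_nat k + 1) * weight x n k"
proof -
  have nz: "denom x n \<noteq> 0" "denom x (Suc n) \<noteq> 0"
    using assms by (auto intro!: denom_nonzero)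
  have "Suc n * (Suc (2 * n - k) choose Suc n) = Suc (2 * n - k) * ((2 * n - k) choose n)"
    by (rule Suc_times_binomial)
  moreover have "Suc (2 * n - k) = 2 * Suc n - Suc k"
    using k by simp
  ultimately have "of_nat (Suc n * ((2 * Suc n - Suc k) choose Suc n)) =
      (of_nat (Suc (2 * n - k) * ((2 * n - k) choose n)) :: complex)"
    by simp
  then have b: "of_nat (Suc n) * of_nat ((2 * Suc n - Suc k) choose Suc n) =
      (2 * of_nat n + 1 - of_nat k) * (of_nat ((2 * n - k) choose n) :: complex)"
    using k by (simp only: of_nat_mult of_nat_Suc) (simp add: of_nat_diff add_ac)
  have w: "weight x (Suc n) (Suc k) * denom x (Suc n) =
      of_nat ((2 * Suc n - Suc k) choose Suc n) * ((x + of_nat (Suc k)) gchoose Suc k)"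
    "weight x n k * denom x n = of_nat ((2 * n - k) choose n) * ((x + of_nat k) gchoose k)"
    using nz k by (simp_all add: weight_def)
  have "of_nat (Suc k) * ((x + 2 * of_nat n + 2) * (x + 2 * of_nat n + 3)) * weight x (Suc n) (Suc k) * denom x n =
      of_nat (Suc k) * weight x (Suc n) (Suc k) * ((x + 2 * of_nat n + 2) * (x + 2 * of_nat n + 3) * denom x n)"
    by (simp only: mult_ac)
  also have "\<dots> = of_nat (Suc k) * (of_nat (Suc n) * (x + of_nat n + 2)) * (weight x (Suc n) (Suc k) * denom x (Suc n))"
    by (subst denom_Suc[symmetric]) (simp only: mult_ac)
  also have "\<dots> = (x + of_nat n + 2) * (of_nat (Suc n) * of_nat ((2 * Suc n - Suc k) choose Suc n)) *
      (of_nat (Suc k) * ((x + of_nat (Suc k)) gchoose Suc k))"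
    by (simp only: w) (simp only: mult_ac)
  also have "\<dots> = (2 * of_nat n + 1 - of_nat k) * (x + of_nat n + 2) * (x + of_nat k + 1) * (weight x n k * denom x n)"
    by (simp only: b gbinomial_diagonal_Suc w) (simp only: mult_ac)
  finally show ?thesis
    using nz by (simp add: mult.assoc)
qed

text \<open>The subtracted (x+1)(x+2) is what the flux out of index 0 contributes in
  \<open>weight_recurrence\<close>.\<close>

lemma weight_Suc_0:
  assumes "\<forall>k\<in>{1..2 * Suc n + 1}. x + of_nat k \<noteq> 0"
  shows "of_nat (Suc n) * ((x + 2 * of_nat n + 2) * (x + 2 * of_nat n + 3)) * weight x (Suc n) 0 =
    of_nat (Suc n) * ((x + 2 * of_nat n + 2) * (x + 2 * of_nat n + 3) - (x + 1) * (x + 2)) * weight x n 0"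
proof -
  have nz: "denom x n \<noteq> 0" "denom x (Suc n) \<noteq> 0"
    using assms by (auto intro!: denom_nonzero)
  have "Suc n * (2 * Suc n choose Suc n) = 2 * (Suc n * ((2 * n + 1) choose n))"
    using Suc_times_binomial[of n "2 * n + 1"] by (simp del: binomial_Suc_Suc)
  also have "Suc n * ((2 * n + 1) choose n) = (2 * n + 1) * ((2 * n) choose n)"
    using binomial_absorb_comp[of "2 * n + 1" n] by simp
  finally have "Suc n * (2 * Suc n choose Suc n) = 2 * (2 * n + 1) * ((2 * n) choose n)"
    by (simp only: mult.assoc)
  then have "of_nat (Suc n * (2 * Suc n choose Suc n)) = (of_nat (2 * (2 * n + 1) * ((2 * n) choose n)) :: complex)"
    by (rule arg_cong)
  then have b: "of_nat (Suc n) * of_nat (2 * Suc n choose Suc n) =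
      2 * (2 * of_nat n + 1) * (of_nat ((2 * n) choose n) :: complex)"
    by (simp only: of_nat_mult of_nat_add of_nat_numeral of_nat_1)
  have w: "weight x (Suc n) 0 * denom x (Suc n) = of_nat (2 * Suc n choose Suc n)"
    "weight x n 0 * denom x n = of_nat (2 * n choose n)"
    using nz by (simp_all add: weight_def)
  have "of_nat (Suc n) * ((x + 2 * of_nat n + 2) * (x + 2 * of_nat n + 3)) * weight x (Suc n) 0 * denom x n =
      of_nat (Suc n) * weight x (Suc n) 0 * ((x + 2 * of_nat n + 2) * (x + 2 * of_nat n + 3) * denom x n)"
    by (simp only: mult_ac)
  also have "\<dots> = of_nat (Suc n) * (of_nat (Suc n) * (x + of_nat n + 2)) * (weight x (Suc n) 0 * denom x (Suc n))"
    by (subst denom_Suc[symmetric]) (simp only: mult_ac)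
  also have "\<dots> = of_nat (Suc n) * (x + of_nat n + 2) * (of_nat (Suc n) * of_nat (2 * Suc n choose Suc n))"
    by (simp only: w) (simp only: mult_ac)
  also have "\<dots> = of_nat (Suc n) * (2 * (2 * of_nat n + 1) * (x + of_nat n + 2)) * (weight x n 0 * denom x n)"
    by (simp only: b w) (simp only: mult_ac)
  also have "2 * (2 * of_nat n + 1) * (x + of_nat n + 2) =
      (x + 2 * of_nat n + 2) * (x + 2 * of_nat n + 3) - (x + 1) * (x + 2)"
    by (simp add: algebra_simps)
  finally show ?thesis
    using nz by simp
qed

section \<open>The recurrence in n\<close>

text \<open>Since y^2 t_k = (x+k+1)^2 (t_k - t_{k+1}), multiplying the sum of w_n(k) t_k/(x+k+1) by
  y^2 gives the coordinates \<open>flux x n (Suc k) - flux x n k\<close>. The value 0 at index 0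
  removes the lower boundary term.\<close>

definition flux :: "complex \<Rightarrow> nat \<Rightarrow> nat \<Rightarrow> complex" where
  "flux x n k = (case k of 0 \<Rightarrow> 0 | Suc j \<Rightarrow> (x + of_nat j + 1) * weight x n j)"

lemma flux_simps [simp]:
  "flux x n 0 = 0" "flux x n (Suc j) = (x + of_nat j + 1) * weight x n j"
  by (simp_all add: flux_def)

text \<open>With a = x+2n+2 the next two factors multiply to 1 + (y - y^2)/(a(a+1)); the even part
  of the new product gives this formula. The proof checks it from the ratios of the weights.\<close>

lemma weight_recurrence:
  assumes "\<forall>k\<in>{1..2 * Suc n + 1}. x + of_nat k \<noteq> 0" and "k \<le> Suc n"
  shows "(x + 2 * of_nat n + 2) * (x + 2 * of_nat n + 3) * (weight x (Suc n) k - weight x n k) =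
    (x + of_nat k + 1) * flux x n k - (x + of_nat k + 2) * flux x n (Suc k)"
proof (cases k)
  case 0
  have "of_nat (Suc n) * ((x + 2 * of_nat n + 2) * (x + 2 * of_nat n + 3) * weight x (Suc n) 0) =
      of_nat (Suc n) * (((x + 2 * of_nat n + 2) * (x + 2 * of_nat n + 3) - (x + 1) * (x + 2)) * weight x n 0)"
    using weight_Suc_0[OF assms(1)] by (simp only: mult.assoc)
  then have "(x + 2 * of_nat n + 2) * (x + 2 * of_nat n + 3) * weight x (Suc n) 0 =
      ((x + 2 * of_nat n + 2) * (x + 2 * of_nat n + 3) - (x + 1) * (x + 2)) * weight x n 0"
    by (simp only: mult_cancel_left of_nat_eq_0_iff) simp
  then show ?thesis
    using 0 by (simp add: algebra_simps)
next
  case (Suc j)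
  then have j: "j \<le> n" using assms(2) by simp
  define N K where "N = (of_nat n :: complex)" and "K = (of_nat j :: complex)"
  define f f1 g where "f = weight x n j" and "f1 = weight x n (Suc j)"
    and "g = weight x (Suc n) (Suc j)"
  have r1: "(K + 1) * (2 * N - K) * f1 = (N - K) * (x + K + 1) * f"
    using weight_Suc_right[OF j, of x] by (simp add: N_def K_def f_def f1_def add.commute)
  have r2: "(K + 1) * ((x + 2 * N + 2) * (x + 2 * N + 3)) * g =
      (2 * N + 1 - K) * (x + N + 2) * (x + K + 1) * f"
    using weight_Suc_Suc[OF assms(1) j] by (simp add: N_def K_def f_def g_def add.commute)
  have nz: "K + 1 \<noteq> 0"
    by (metis K_def of_nat_Suc of_nat_eq_0_iff add.commute nat.distinct(1))
  \<comment> \<open>The collected coefficient of \<open>f1\<close> contains the factor 2N-K, so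
    \<open>r1\<close> applies without dividing by 2N-K, which is 0 when n = j = 0.\<close>
  have "(K + 1) * ((x + 2 * N + 2) * (x + 2 * N + 3) * (g - f1)) =
      (K + 1) * ((x + K + 2) * (x + K + 1) * f - (x + K + 3) * (x + K + 2) * f1)"
    using r1 r2 by algebra
  then have "(x + 2 * N + 2) * (x + 2 * N + 3) * (g - f1) =
      (x + K + 2) * (x + K + 1) * f - (x + K + 3) * (x + K + 2) * f1"
    using nz by (simp only: mult_cancel_left) simp
  then show ?thesis
    by (simp add: Suc N_def K_def f_def f1_def g_def add_ac mult.assoc)
qed

section \<open>The three weighted sums\<close>

text \<open>These are, up to sign, the coefficients of 1, y and y^2 in the product. They are proved
  together because the step for each sum uses the earlier ones.\<close>

lemma weight_sums:
  fixes x :: complex and n :: nat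
  defines "D \<equiv> \<lambda>n. harm1 n (x / 2) - harm1 n ((x + 1) / 2)"
  assumes "\<forall>k\<in>{1..2 * n + 1}. x + of_nat k \<noteq> 0"
  shows "(\<Sum>k\<le>n. weight x n k) = 1 \<and>
    (\<Sum>k\<le>n. weight x n k / (x + of_nat k + 1)) = 1 / (x + 1) - D n / 2 \<and>
    (\<Sum>k\<le>n. weight x n k * gen_harm 2 k x) =
      (4 * gen_harm 2 (2 * n) (x + 1) - D n * (D n - 4 / (x + 1))) / 8"
  using assms(2)
proof (induction n)
  case 0
  then show ?case by (simp add: weight_def denom_def D_def)
next
  case (Suc n)
  define a where "a = x + 2 * of_nat n + 2"
  have nz: "x + of_nat k + 1 \<noteq> 0" if "k \<le> 2 * n + 2" for k
    using Suc.prems[rule_format, of "Suc k"] that by (simp add: add_ac)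
  have a: "a \<noteq> 0" "a + 1 \<noteq> 0" "x + 1 \<noteq> 0"
    using nz[of "2 * n + 1"] nz[of "2 * n + 2"] nz[of 0] by (simp_all add: a_def add_ac)
  define S where "S = 1 / (x + 1) - D n / 2"
  define w where "w = weight x n"
  define v where "v = flux x n"
  \<comment> \<open>Hence the level-n sums may also run up to n+1.\<close>
  have w0: "w k = 0" if "k > n" for k
    using that by (simp add: w_def weight_def)
  have vS: "v (Suc k) = (x + of_nat k + 1) * w k" for k
    by (simp add: v_def w_def)
  have A: "(\<Sum>k\<le>Suc n. w k) = 1"
    and B: "(\<Sum>k\<le>Suc n. w k / (x + of_nat k + 1)) = S"
    and C: "(\<Sum>k\<le>Suc n. w k * gen_harm 2 k x) =
      (4 * gen_harm 2 (2 * n) (x + 1) - D n * (D n - 4 / (x + 1))) / 8"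
    using Suc.IH Suc.prems by (simp_all add: w_def[symmetric] w0 S_def)
  have rec: "weight x (Suc n) k =
      w k + ((x + of_nat k + 1) * v k - (x + of_nat k + 2) * v (Suc k)) / (a * (a + 1))"
    if "k \<le> Suc n" for k
  proof -
    have "a * (a + 1) * (weight x (Suc n) k - w k) =
        (x + of_nat k + 1) * v k - (x + of_nat k + 2) * v (Suc k)"
      using weight_recurrence[OF Suc.prems that]
      by (simp add: w_def v_def a_def add.assoc del: flux_simps)
    then have "weight x (Suc n) k - w k =
        ((x + of_nat k + 1) * v k - (x + of_nat k + 2) * v (Suc k)) / (a * (a + 1))"
      using a by (metis no_zero_divisors nonzero_mult_div_cancel_left)
    then show ?thesis
      by (simp add: diff_eq_eq add.commute)
  qed
  \<comment> \<open>\<open>V\<close> vanishes at 0 and at n+2, so neither telescoping nor summation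
    by parts leaves a boundary term.\<close>
  define V where "V k = (x + of_nat k + 1) * v k / (a * (a + 1))" for k
  have V: "V 0 = 0" "V (Suc (Suc n)) = 0"
    by (simp_all add: V_def v_def weight_def)
  have rec': "weight x (Suc n) k = w k + (V k - V (Suc k))" if "k \<le> Suc n" for k
    by (simp add: rec[OF that] V_def diff_divide_distrib add_ac)
  have A': "(\<Sum>k\<le>Suc n. weight x (Suc n) k) = 1"
  proof -
    have "(\<Sum>k\<le>Suc n. weight x (Suc n) k) = (\<Sum>k\<le>Suc n. w k + (V k - V (Suc k)))"
      by (intro sum.cong) (auto simp: rec')
    also have "\<dots> = (\<Sum>k\<le>Suc n. w k) + (\<Sum>k\<le>Suc n. V k - V (Suc k))"
      by (rule sum.distrib)
    finally show ?thesis
      by (simp only: A sum_telescope_atMost V) simp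
  qed
  have D': "D (Suc n) = D n + 2 / (a * (a + 1))"
  proof -
    have "x / 2 + of_nat (Suc n) = a / 2" "(x + 1) / 2 + of_nat (Suc n) = (a + 1) / 2"
      by (simp_all add: a_def field_simps)
    moreover have "D (Suc n) = D n +
        (1 / (x / 2 + of_nat (Suc n)) - 1 / ((x + 1) / 2 + of_nat (Suc n)))"
      by (simp add: D_def gen_harm_Suc)
    ultimately have "D (Suc n) = D n + (2 / a - 2 / (a + 1))"
      by (simp only:) simp
    also have "2 / a - 2 / (a + 1) = 2 / (a * (a + 1))"
      using a by (simp add: field_simps)
    finally show ?thesis .
  qed
  have B': "(\<Sum>k\<le>Suc n. weight x (Suc n) k / (x + of_nat k + 1)) = 1 / (x + 1) - D (Suc n) / 2"
  proof -
    \<comment> \<open>Writing x+k+2 = (x+k+1) + 1 in \<open>rec\<close> splits off a multiple of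
      \<open>w k\<close>; the rest telescopes.\<close>
    have "weight x (Suc n) k / (x + of_nat k + 1) =
        w k / (x + of_nat k + 1) - w k / (a * (a + 1)) + (v k - v (Suc k)) / (a * (a + 1))"
      if "k \<le> Suc n" for k
    proof -
      have "x + of_nat k + 1 \<noteq> 0" using nz[of k] that by simp
      then show ?thesis
        unfolding rec[OF that] vS using a
        by (simp add: divide_simps) (simp add: algebra_simps)
    qed
    then have "(\<Sum>k\<le>Suc n. weight x (Suc n) k / (x + of_nat k + 1)) =
        (\<Sum>k\<le>Suc n. w k / (x + of_nat k + 1) - w k / (a * (a + 1)) + (v k - v (Suc k)) / (a * (a + 1)))"
      by (intro sum.cong) auto
    also have "\<dots> = (\<Sum>k\<le>Suc n. w k / (x + of_nat k + 1)) - (\<Sum>k\<le>Suc n. w k) / (a * (a + 1)) +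
        (\<Sum>k\<le>Suc n. v k - v (Suc k)) / (a * (a + 1))"
      by (simp only: sum_divide_distrib) (simp only: sum.distrib sum_subtractf)
    also have "\<dots> = S - 1 / (a * (a + 1))"
      by (simp only: A B sum_telescope_atMost) (simp add: v_def weight_def)
    finally show ?thesis
      by (simp add: D' S_def add_divide_distrib)
  qed
  have "(\<Sum>k\<le>Suc n. weight x (Suc n) k * gen_harm 2 k x) =
      (\<Sum>k\<le>Suc n. w k * gen_harm 2 k x + (V k - V (Suc k)) * gen_harm 2 k x)"
    by (intro sum.cong) (auto simp: rec' distrib_right)
  also have "\<dots> = (\<Sum>k\<le>Suc n. w k * gen_harm 2 k x) +
      (\<Sum>k\<le>Suc n. V (Suc k) * (gen_harm 2 (Suc k) x - gen_harm 2 k x))"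
    using summation_by_parts[of V "\<lambda>k. gen_harm 2 k x" "Suc n"] V
    by (simp only: sum.distrib) simp
  \<comment> \<open>The increment 1/(x+k+1)^2 reduces the factor (x+k+2)(x+k+1) to 1 + 1/(x+k+1), so
    \<open>A\<close> and \<open>B\<close> evaluate the sum.\<close>
  also have "(\<Sum>k\<le>Suc n. V (Suc k) * (gen_harm 2 (Suc k) x - gen_harm 2 k x)) =
      (\<Sum>k\<le>Suc n. (w k + w k / (x + of_nat k + 1)) / (a * (a + 1)))"
  proof (intro sum.cong refl)
    fix k assume "k \<in> {..Suc n}"
    then have "x + of_nat k + 1 \<noteq> 0" using nz[of k] by simp
    then have "(x + of_nat k + 1 + 1) * ((x + of_nat k + 1) * w k) / (a * (a + 1)) *
        (1 / (x + of_nat k + 1)\<^sup>2) = (w k + w k / (x + of_nat k + 1)) / (a * (a + 1))"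
      using a by (simp add: divide_simps power2_eq_square) (simp add: algebra_simps)
    moreover have "gen_harm 2 (Suc k) x - gen_harm 2 k x = 1 / (x + of_nat k + 1)\<^sup>2"
      by (simp add: gen_harm_Suc add_ac)
    moreover have "V (Suc k) = (x + of_nat k + 1 + 1) * ((x + of_nat k + 1) * w k) / (a * (a + 1))"
      by (simp add: V_def vS add_ac)
    ultimately show "V (Suc k) * (gen_harm 2 (Suc k) x - gen_harm 2 k x) =
        (w k + w k / (x + of_nat k + 1)) / (a * (a + 1))"
      by (simp only:)
  qed
  also have "\<dots> = (1 + S) / (a * (a + 1))"
    by (simp only: sum_divide_distrib[symmetric] sum.distrib A B)
  finally have C': "(\<Sum>k\<le>Suc n. weight x (Suc n) k * gen_harm 2 k x) =
      (4 * gen_harm 2 (2 * n) (x + 1) - D n * (D n - 4 / (x + 1))) / 8 + (1 + S) / (a * (a + 1))"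
    by (simp only: C)
  have H': "gen_harm 2 (2 * Suc n) (x + 1) = gen_harm 2 (2 * n) (x + 1) + 1 / a\<^sup>2 + 1 / (a + 1)\<^sup>2"
    by (simp add: gen_harm_Suc a_def add_ac)
  \<comment> \<open>Used with p = 1/a, q = 1/(a+1), r = 1/(x+1). Squaring p - q = pq gives p^2 + q^2
    = (pq)^2 + 2pq, and 4(pq)^2 cancels the square of the increment 2pq of d.\<close>
  have alg: "(4 * H - d * (d - 4 * r)) / 8 + (1 + (r - d / 2)) * (p * q) =
      (4 * (H + p\<^sup>2 + q\<^sup>2) - (d + 2 * (p * q)) * (d + 2 * (p * q) - 4 * r)) / 8"
    if "p - q = p * q" for H d r p q :: complex
  proof -
    have "p\<^sup>2 + q\<^sup>2 = (p * q)\<^sup>2 + 2 * (p * q)"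
      using that by algebra
    then have "4 * (H + p\<^sup>2 + q\<^sup>2) = 4 * (H + (p * q)\<^sup>2 + 2 * (p * q))"
      by (simp add: add.assoc)
    then show ?thesis
      by (simp only:) (simp add: field_simps power2_eq_square)
  qed
  have "1 / a - 1 / (a + 1) = (1 / a) * (1 / (a + 1))"
    using a by (simp add: field_simps)
  from alg[OF this, of "gen_harm 2 (2 * n) (x + 1)" "D n" "1 / (x + 1)"]
  have "(\<Sum>k\<le>Suc n. weight x (Suc n) k * gen_harm 2 k x) =
      (4 * gen_harm 2 (2 * Suc n) (x + 1) - D (Suc n) * (D (Suc n) - 4 / (x + 1))) / 8"
    unfolding C' H' D' S_def by (simp add: power_divide)
  with A' B' show ?case by blast
qed

theorem theorem4:
  fixes x :: complex and n :: nat
  assumes "\<forall>k\<in>{1..2 * n + 1}. x + of_nat k \<noteq> 0"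
  shows "(\<Sum>k=0..n. of_nat ((2 * n - k) choose n) * ((x + of_nat k) gchoose k) * gen_harm 2 k x) =
    ((x + 2 * of_nat n + 1) gchoose n) / 8 *
      (4 * gen_harm 2 (2 * n) (x + 1)
       - (harm1 n (x / 2) - harm1 n ((x + 1) / 2)) *
         (harm1 n (x / 2) - harm1 n ((x + 1) / 2) - 4 / (x + 1)))"
proof -
  have "(\<Sum>k=0..n. of_nat ((2 * n - k) choose n) * ((x + of_nat k) gchoose k) * gen_harm 2 k x) =
      denom x n * (\<Sum>k\<le>n. weight x n k * gen_harm 2 k x)"
    unfolding sum_distrib_left
    using denom_nonzero[OF assms] by (intro sum.cong) (auto simp: weight_def)
  also have "(\<Sum>k\<le>n. weight x n k * gen_harm 2 k x) =
      (4 * gen_harm 2 (2 * n) (x + 1)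
       - (harm1 n (x / 2) - harm1 n ((x + 1) / 2)) *
         (harm1 n (x / 2) - harm1 n ((x + 1) / 2) - 4 / (x + 1))) / 8"
    using weight_sums[OF assms] by blast
  finally show ?thesis
    by (simp add: denom_def)
qed

end
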